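(* (Matrix Liberation Lemma) Let $n=2p$, let $N$ be an $n\times n$ real positive definite matrix with labeled graph $G^L$, let $R$ be a matrix in the subspace $\{NM+M^\top N: M\in\mathfrak{sp}(2p)\}$, and let $G^L_R$ be the labeled graph of $G^L$ in the direction of $R$. If $N$ has the SSSP with respect to $G^L_R$, then there is a positive definite matrix with labeled graph $G^L_R$ that has the same symplectic eigenvalues (with multiplicities) as $N$ and has the SSSP.
   Context: $\Omega=\begin{bmatrix}O&I_p\\ -I_p&O\end{bmatrix}$; a real $2p\times2p$ matrix $S$ is symplectic if $S^\top\Omega S=\Omega$. Positive definite matrices are real symmetric. By Williamson's theorem, for each $2p\times 2p$ positive definite $N$ there is a symplectic $S$ with $S^\top NS=D\oplus D$, $D$ a $p\times p$ diagonal matrix whose diagonal entries are positive and unique up to order; these are the symplectic eigenvalues of $N$. Labeled graphs of order $2p$ are simple graphs on vertex set $\{1,\dots,2p\}$. The labeled graph $\mathcal G^L(N)$ of a positive definite $N=[n_{ij}]$ has edges $\{ij: i\ne j,\ n_{ij}\neq0\}$. For a labeled graph $G^L$, $\mathcal S(G^L)$ is the set of real symmetric matrices $A=[a_{ij}]$ such that for $i\ne j$, $a_{ij}\ne0$ if and only if $ij$ is an edge (diagonal entries arbitrary). $\mathfrak{sp}(2p)$ is the space of Hamiltonian matrices $\begin{bmatrix}R_0&E\\ F&-R_0^\top\end{bmatrix}$ with $R_0,E,F$ real $p\times p$ and $E,F$ symmetric. $\mathrm{Symm}(2p)$ is the space of real symmetric $2p\times2p$ matrices. A positive definite $2p\times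 2p$ matrix $N$ has the Strong Symplectic Spectral Property (SSSP) if $\{NM+M^\top N: M\in\mathfrak{sp}(2p)\}+\operatorname{Span}\mathcal S(\mathcal G^L(N))=\mathrm{Symm}(2p)$. For $R=[r_{ij}]$ in $\{NM+M^\top N: M\in\mathfrak{sp}(2p)\}$, the labeled graph $G^L_R$ of $G^L$ in the direction of $R$ is obtained from $G^L$ by inserting an edge joining $i$ and $j$, if not already present, whenever $i\ne j$ and $r_{ij}\neq0$. $N$ has the SSSP with respect to $G^L_R$ if $\{NM+M^\top N: M\in\mathfrak{sp}(2p)\}+\operatorname{Span}\mathcal S(G^L_R)=\mathrm{Symm}(2p)$. *)

theory Defs
  imports "HOL-Analysis.Analysis" "HOL-Library.Multiset" "HOL-Library.Set_Algebras"
begin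

(* A real 2p x 2p matrix is indexed by 'p + 'p with p = CARD('p): Inl and Inr are the first
   and the second half of the index set {1..2p}. *)

definition block_mat ::
  "real^'p^'p \<Rightarrow> real^'p^'p \<Rightarrow> real^'p^'p \<Rightarrow> real^'p^'p \<Rightarrow> real^('p::finite + 'p)^('p + 'p)"
where
  "block_mat A B C D = (\<chi> i j.
     case i of
       Inl k \<Rightarrow> (case j of Inl l \<Rightarrow> A $ k $ l | Inr l \<Rightarrow> B $ k $ l)
     | Inr k \<Rightarrow> (case j of Inl l \<Rightarrow> C $ k $ l | Inr l \<Rightarrow> D $ k $ l))"

definition Omega :: "real^('p::finite + 'p)^('p + 'p)" where
  "Omega = block_mat 0 (mat 1) (- mat 1) 0"

definition symplectic :: "real^('p::finite + 'p)^('p + 'p) \<Rightarrow> bool" where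
  "symplectic S \<longleftrightarrow> transpose S ** Omega ** S = Omega"

definition Symm :: "(real^'n^'n::finite) set" where
  "Symm = {A. transpose A = A}"

definition pos_def :: "real^'n^'n::finite \<Rightarrow> bool" where
  "pos_def N \<longleftrightarrow> N \<in> Symm \<and> (\<forall>x. x \<noteq> 0 \<longrightarrow> x \<bullet> (N *v x) > 0)"

definition williamson_form ::
  "real^('p::finite + 'p)^('p + 'p) \<Rightarrow> real^'p^'p \<Rightarrow> bool"
where
  "williamson_form N D \<longleftrightarrow>
     (\<forall>i j. i \<noteq> j \<longrightarrow> D $ i $ j = 0) \<and> (\<forall>i. D $ i $ i > 0) \<and>
     (\<exists>S. symplectic S \<and> transpose S ** N ** S = block_mat D 0 0 D)"

(* For positive definite N the multiset exists and is unique by Williamson's theorem. *)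
definition symplectic_eigenvalues :: "real^('p::finite + 'p)^('p + 'p) \<Rightarrow> real multiset" where
  "symplectic_eigenvalues N =
     (THE m. \<exists>D. williamson_form N D \<and> m = image_mset (\<lambda>i. D $ i $ i) (mset_set UNIV))"

(* A labeled graph is given by its edge set, a set of two-element sets of indices. *)

definition labeled_graph :: "real^'n^'n::finite \<Rightarrow> 'n set set" where
  "labeled_graph N = {{i, j} | i j. i \<noteq> j \<and> N $ i $ j \<noteq> 0}"

definition graph_matrices :: "'n set set \<Rightarrow> (real^'n^'n::finite) set" where
  "graph_matrices G = {A \<in> Symm. \<forall>i j. i \<noteq> j \<longrightarrow> (A $ i $ j \<noteq> 0 \<longleftrightarrow> {i, j} \<in> G)}"

definition directed_extension :: "'n set set \<Rightarrow> real^'n^'n::finite \<Rightarrow> 'n set set" where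
  "directed_extension G R = G \<union> {{i, j} | i j. i \<noteq> j \<and> R $ i $ j \<noteq> 0}"

definition hamiltonian_matrices :: "(real^('p::finite + 'p)^('p + 'p)) set" where
  "hamiltonian_matrices =
     {block_mat R0 E F (- transpose R0) | R0 E F. E \<in> Symm \<and> F \<in> Symm}"

definition sp_tangent ::
  "real^('p::finite + 'p)^('p + 'p) \<Rightarrow> (real^('p + 'p)^('p + 'p)) set"
where
  "sp_tangent N = {N ** M + transpose M ** N | M. M \<in> hamiltonian_matrices}"

(* The sum of subspaces is the elementwise sum of sets. *)
definition SSSP_wrt :: "real^('p::finite + 'p)^('p + 'p) \<Rightarrow> ('p + 'p) set set \<Rightarrow> bool" where
  "SSSP_wrt N G \<longleftrightarrow> sp_tangent N + span (graph_matrices G) = Symm"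

definition SSSP :: "real^('p::finite + 'p)^('p + 'p) \<Rightarrow> bool" where
  "SSSP N \<longleftrightarrow> SSSP_wrt N (labeled_graph N)"

end

theory Submission
  imports Defs
begin

text \<open>
  Congruence by a symplectic matrix \<open>S\<close> keeps a matrix positive definite and keeps its symplectic
  eigenvalues, so it suffices to look for the new matrix among the \<open>S\<^sup>T N S\<close> with \<open>S\<close> near the
  identity. Write \<open>R = N M + M\<^sup>T N\<close> with \<open>M\<close> Hamiltonian. To first order, \<open>S = I + t M\<close> is
  symplectic and moves \<open>N\<close> to \<open>N + t R\<close>, whose graph for small \<open>t > 0\<close> is exactly the graph of
  \<open>N\<close> in the direction of \<open>R\<close>. What remains is to correct \<open>S\<close> by a term of order \<open>t\<^sup>2\<close> so that
  it becomes exactly symplectic and so that the entries of \<open>S\<^sup>T N S\<close> outside that graph vanish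
  exactly. A correction of order \<open>t\<^sup>2\<close> cannot annihilate an entry that is nonzero in \<open>N\<close> or in
  \<open>R\<close>.

  Put \<open>S = I + X\<close>. The two requirements on \<open>S\<close> together form one equation \<open>L X + Q X = 0\<close> in
  the entries of \<open>X\<close>, with \<open>L\<close> linear and \<open>Q\<close> homogeneous quadratic, and \<open>L M = 0\<close>. The SSSP with
  respect to the extended graph implies that the range of \<open>L\<close> contains the values of \<open>Q\<close>. Under that
  condition the equation has solutions \<open>X = t M + O(t\<^sup>2)\<close>, which Brouwer's fixed point theorem
  yields (\<open>perturbed_linear_equation_solvable\<close>, \<open>symplectic_orbit_meets_pattern\<close>). Treating
  the symplectic condition as part of the system, with \<open>X\<close> ranging over all matrices, is what
  makes the system exactly quadratic.

  Finally, for a fixed graph the SSSP asserts that a linear map depending continuously on \<open>N\<close> is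
  onto the symmetric matrices, which is an open condition (\<open>SSSP_wrt_open\<close>). So the new
  matrix has the SSSP with respect to the extended graph, and this is its own graph.
\<close>

section \<open>Stability of linear equations\<close>

lemma linear_norm_bound:
  fixes g :: "'a::euclidean_space \<Rightarrow> 'b::euclidean_space"
  assumes "linear g"
  obtains c where "c > 0" "\<And>y. norm (g y) \<le> c * norm y"
  using bounded_linear.pos_bounded[OF linear_conv_bounded_linear[THEN iffD1, OF assms]]
  by (metis mult.commute)

text \<open>
  A substitute for the implicit function theorem at a kernel vector \<open>v\<close>, with a quadratic error.
  With a right inverse \<open>g\<close> of \<open>L\<close> on its range, the ansatz \<open>x = t v + g w\<close> turns the equation into
  the fixed point problem \<open>w = - Q (t v + g w)\<close>. For \<open>w\<close> of size \<open>O(t\<^sup>2)\<close> the right-hand side is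
  again \<open>O(t\<^sup>2)\<close> with the same constant, so Brouwer's theorem applies on a ball of that radius; a
  fixed point lies in the range of \<open>L\<close> because \<open>Q\<close> takes its values there.
\<close>
lemma perturbed_linear_equation_solvable:
  fixes L Q :: "'a::euclidean_space \<Rightarrow> 'b::euclidean_space"
  assumes L: "linear L" and Lv: "L v = 0"
    and Q: "continuous_on UNIV Q" "\<And>x. norm (Q x) \<le> C * (norm x)\<^sup>2" "range Q \<subseteq> range L"
  obtains K where "K \<ge> 0"
    "\<forall>\<^sub>F t in at_right 0. \<exists>x. L x + Q x = 0 \<and> norm (x - t *\<^sub>R v) \<le> K * t\<^sup>2"
proof -
  obtain g where g: "linear g" "\<And>w. w \<in> range L \<Longrightarrow> L (g w) = w"
    using linear_exists_right_inverse_on[OF L subspace_UNIV] by blast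
  obtain c where c: "c > 0" "\<And>w. norm (g w) \<le> c * norm w"
    using linear_norm_bound[OF g(1)] by blast
  define C' where "C' = max C 1"
  have Q': "norm (Q x) \<le> C' * (norm x)\<^sup>2" for x
    by (rule order_trans[OF Q(2)]) (simp add: C'_def mult_right_mono)
  \<comment> \<open>If \<open>norm (g w) \<le> t\<close>, then \<open>norm (t v + g w) \<le> t (norm v + 1)\<close>, so \<open>D t\<^sup>2\<close> bounds \<open>Q\<close> there.\<close>
  define D where "D = C' * (norm v + 1)\<^sup>2"
  have "C' > 0" by (simp add: C'_def)
  moreover have "norm v + 1 > 0" by (simp add: add_nonneg_pos)
  ultimately have D: "D > 0" by (simp add: D_def)
  have sol: "\<exists>x. L x + Q x = 0 \<and> norm (x - t *\<^sub>R v) \<le> c * D * t\<^sup>2"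
    if t: "0 < t" "t < 1 / (c * D)" for t
  proof -
    define F where "F w = - Q (t *\<^sub>R v + g w)" for w
    have small: "norm (t *\<^sub>R v + g w) \<le> t * (norm v + 1)" if "w \<in> cball 0 (D * t\<^sup>2)" for w
    proof -
      have "norm (g w) \<le> c * (D * t\<^sup>2)"
        using that c by (meson mem_cball_0 mult_left_mono less_imp_le order_trans)
      also have "\<dots> \<le> t"
        using t c(1) D by (simp add: field_simps power2_eq_square)
      finally have "norm (t *\<^sub>R v + g w) \<le> t * norm v + t"
        using t by (intro norm_triangle_le) simp
      thus ?thesis by (simp add: algebra_simps)
    qed
    have "F \<in> cball 0 (D * t\<^sup>2) \<rightarrow> cball 0 (D * t\<^sup>2)"
    proof
      fix w :: 'b assume "w \<in> cball 0 (D * t\<^sup>2)"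
      from small[OF this] have "(norm (t *\<^sub>R v + g w))\<^sup>2 \<le> (t * (norm v + 1))\<^sup>2"
        by (intro power_mono) auto
      hence "norm (F w) \<le> C' * (t * (norm v + 1))\<^sup>2"
        unfolding F_def norm_minus_cancel using \<open>C' > 0\<close>
        by (intro order_trans[OF Q'] mult_left_mono) auto
      thus "F w \<in> cball 0 (D * t\<^sup>2)"
        by (simp add: D_def power_mult_distrib mult_ac)
    qed
    moreover have "continuous_on (cball 0 (D * t\<^sup>2)) F"
      unfolding F_def
      by (intro continuous_intros continuous_on_compose2[OF Q(1)] linear_continuous_on
          linear_conv_bounded_linear[THEN iffD1] g(1)) auto
    ultimately obtain w where w: "w \<in> cball 0 (D * t\<^sup>2)" "F w = w"
      using brouwer_ball[of "D * t\<^sup>2" 0 F] D t(1) by auto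
    define x where "x = t *\<^sub>R v + g w"
    have Qx: "Q x = - w" using w(2) by (simp add: F_def x_def equation_minus_iff)
    have "- Q x \<in> range L"
      using Q(3) by (intro subspace_neg linear_subspace_image[OF L] subspace_UNIV) auto
    hence "L (g w) = w" using g(2) Qx by simp
    hence "L x = w" by (simp add: x_def linear_add[OF L] linear_scale[OF L] Lv)
    moreover have "norm (x - t *\<^sub>R v) \<le> c * D * t\<^sup>2"
      using order_trans[OF c(2) mult_left_mono[of "norm w" "D * t\<^sup>2" c]] w(1) c(1)
      by (simp add: x_def mult.assoc)
    ultimately show ?thesis using Qx by (intro exI[of _ x]) simp
  qed
  have "0 < 1 / (c * D)" using c(1) D by simp
  hence "\<forall>\<^sub>F t in at_right 0. \<exists>x. L x + Q x = 0 \<and> norm (x - t *\<^sub>R v) \<le> c * D * t\<^sup>2"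
    unfolding eventually_at_right_field using sol by blast
  moreover have "c * D \<ge> 0" using c(1) D by simp
  ultimately show ?thesis using that by blast
qed

text \<open>
  Compose \<open>B\<close> with a right inverse of \<open>A\<close> on \<open>V\<close>: the result maps \<open>V\<close> into itself at distance at
  most one half from the identity, so it is injective and, by dimension, onto.
\<close>
lemma surjection_onto_subspace_stable:
  fixes A :: "'a::euclidean_space \<Rightarrow> 'b::euclidean_space"
  assumes A: "linear A" and U: "subspace U" and V: "A ` U = V"
  obtains e where "e > 0"
    "\<And>B. \<lbrakk>linear B; B ` U \<subseteq> V; \<And>x. norm (B x - A x) \<le> e * norm x\<rbrakk> \<Longrightarrow> B ` U = V"
proof -
  obtain g where g: "linear g" "range g \<subseteq> U" "\<And>y. y \<in> V \<Longrightarrow> A (g y) = y"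
    using linear_exists_right_inverse_on[OF A U] V by blast
  obtain c where c: "c > 0" "\<And>y. norm (g y) \<le> c * norm y"
    using linear_norm_bound[OF g(1)] by blast
  show ?thesis
  proof (rule that)
    show "1 / (2 * c) > 0" using c(1) by simp
  next
    fix B assume B: "linear B" "B ` U \<subseteq> V" "\<And>x. norm (B x - A x) \<le> 1 / (2 * c) * norm x"
    have sV: "subspace V" using linear_subspace_image[OF A U] V by simp
    have lin: "linear (B \<circ> g)" using g(1) B(1) by (rule linear_compose)
    have "y = 0" if y: "y \<in> V" "(B \<circ> g) y = 0" for y
    proof -
      have "norm y = norm (B (g y) - A (g y))" using y g(3) by simp
      also have "\<dots> \<le> 1 / (2 * c) * (c * norm y)"
        using c by (intro order_trans[OF B(3)] mult_left_mono) auto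
      also have "\<dots> = norm y / 2" using c(1) by simp
      finally show ?thesis by simp
    qed
    hence inj: "inj_on (B \<circ> g) V"
      using linear_injective_on_subspace_0[OF lin sV] by blast
    have sub: "(B \<circ> g) ` V \<subseteq> V" using B(2) g(2) by (auto simp: image_subset_iff)
    have "dim ((B \<circ> g) ` V) = dim V"
      using inj sV by (intro dim_image_eq[OF lin]) (metis span_eq_iff)
    hence "(B \<circ> g) ` V = V"
      by (intro subspace_dim_equal linear_subspace_image[OF lin] sV sub) simp
    thus "B ` U = V" using B(2) g(2) by (force simp: image_subset_iff)
  qed
qed

section \<open>Congruence of matrices\<close>

text \<open>
  The derivative at the identity of \<open>S \<mapsto> S\<^sup>T A S\<close>. For \<open>A = Omega\<close> its kernel is the Lie algebra of
  the symplectic group; for \<open>A = N\<close> the image of that Lie algebra is the tangent space of the orbit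
  of \<open>N\<close>. One notation thus serves both halves of the system to be solved.
\<close>
definition congruence_derivative :: "real^'n^'n::finite \<Rightarrow> real^'n^'n \<Rightarrow> real^'n^'n" where
  "congruence_derivative A X = A ** X + transpose X ** A"

lemma transpose_add: "transpose (A + B) = transpose A + transpose (B :: real^'n^'m)"
  by (simp add: transpose_def vec_eq_iff)

lemma transpose_minus: "transpose (- A) = - transpose (A :: real^'n^'m)"
  by (simp add: transpose_def vec_eq_iff)

lemma matrix_mult_scaleR:
  fixes A :: "real^'n^'m" and B :: "real^'k^'n"
  shows "(r *\<^sub>R A) ** B = r *\<^sub>R (A ** B)" "A ** (r *\<^sub>R B) = r *\<^sub>R (A ** B)"
  by (simp_all add: matrix_matrix_mult_def vec_eq_iff sum_distrib_left mult_ac)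

lemma matrix_mult_minus:
  fixes A :: "real^'n^'m" and B :: "real^'k^'n"
  shows "(- A) ** B = - (A ** B)" "A ** (- B) = - (A ** B)"
  by (simp_all add: matrix_matrix_mult_def vec_eq_iff sum_negf)

lemma matrix_add_rdistrib:
  fixes A B :: "real^'n^'m" and C :: "real^'k^'n"
  shows "(A + B) ** C = A ** C + B ** C"
  by (simp add: matrix_matrix_mult_def vec_eq_iff sum.distrib distrib_right)

lemmas matrix_linear_simps = transpose_add transpose_minus transpose_scalar
  matrix_mult_scaleR matrix_mult_minus matrix_add_ldistrib matrix_add_rdistrib

lemma bounded_bilinear_congruence_derivative: "bounded_bilinear congruence_derivative"
  unfolding bilinear_conv_bounded_bilinear[symmetric] bilinear_def congruence_derivative_def
  by (auto intro!: linearI simp: matrix_linear_simps algebra_simps)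

lemma bounded_bilinear_transpose_mult:
  "bounded_bilinear (\<lambda>X Y. transpose X ** A ** (Y :: real^'n^'n::finite))"
  unfolding bilinear_conv_bounded_bilinear[symmetric] bilinear_def
  by (auto intro!: linearI simp: matrix_linear_simps)

lemma linear_congruence_derivative: "linear (congruence_derivative A)"
  by (rule bounded_linear.linear)
    (rule bounded_bilinear.bounded_linear_right[OF bounded_bilinear_congruence_derivative])

lemma congruence_expansion:
  "transpose (mat 1 + X) ** A ** (mat 1 + X) =
     A + congruence_derivative A X + transpose X ** A ** X"
  by (simp add: congruence_derivative_def matrix_linear_simps algebra_simps matrix_mul_assoc)

lemma subspace_Symm: "subspace Symm"
  by (auto simp: Symm_def subspace_def matrix_linear_simps) (simp add: transpose_def vec_eq_iff)

lemma Symm_congruence: "N \<in> Symm \<Longrightarrow> transpose X ** N ** X \<in> Symm"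
  by (simp add: Symm_def matrix_transpose_mul matrix_mul_assoc)

lemma Symm_congruence_derivative: "N \<in> Symm \<Longrightarrow> congruence_derivative N X \<in> Symm"
  by (simp add: Symm_def congruence_derivative_def matrix_transpose_mul transpose_add add.commute)

section \<open>The symplectic form\<close>

lemma Omega_mult_nth:
  fixes A :: "real^'n^('p::finite + 'p)"
  shows "(Omega ** A) $ Inl k $ j = A $ Inr k $ j"
  "(Omega ** A) $ Inr k $ j = - A $ Inl k $ j"
proof -
  have sum_halves: "sum f UNIV = (\<Sum>k\<in>UNIV. f (Inl k)) + (\<Sum>k\<in>UNIV. f (Inr k))"
    for f :: "'p + 'p \<Rightarrow> real"
    using sum.Plus[of UNIV UNIV f] by (simp add: comp_def)
  show "(Omega ** A) $ Inl k $ j = A $ Inr k $ j" "(Omega ** A) $ Inr k $ j = - A $ Inl k $ j"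
    by (simp_all add: Omega_def block_mat_def matrix_matrix_mult_def mat_def sum_halves sum_negf
        if_distrib[of "\<lambda>x. x * _"] if_distrib[of uminus] cong: if_cong)
qed

lemma Omega_squared: "Omega ** Omega = - mat 1"
proof -
  have "(Omega ** Omega) $ i $ j = (- mat 1 :: real^('a+'a)^('a+'a)) $ i $ j" for i j :: "'a + 'a"
    by (cases i; cases j) (simp_all add: Omega_mult_nth, simp_all add: Omega_def block_mat_def mat_def)
  thus ?thesis by (simp add: vec_eq_iff)
qed

lemma transpose_Omega: "transpose Omega = - Omega"
proof -
  have "transpose Omega $ i $ j = (- Omega :: real^('a+'a)^('a+'a)) $ i $ j" for i j :: "'a + 'a"
    by (cases i; cases j) (simp_all add: transpose_def Omega_def block_mat_def mat_def)
  thus ?thesis by (simp add: vec_eq_iff)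
qed

text \<open>
  Left multiplication by \<open>Omega\<close> swaps the block rows with a sign, so the block description of
  Hamiltonian matrices is symmetry of \<open>Omega ** M\<close>; as \<open>Omega\<close> is skew, this is the linearisation of
  \<open>S\<^sup>T Omega S = Omega\<close>.
\<close>
lemma hamiltonian_iff_derivative_zero:
  "M \<in> hamiltonian_matrices \<longleftrightarrow> congruence_derivative Omega M = 0"
proof -
  have "congruence_derivative Omega M = 0 \<longleftrightarrow> Omega ** M \<in> Symm"
    unfolding congruence_derivative_def Symm_def
    by (simp add: matrix_transpose_mul transpose_Omega matrix_linear_simps neg_eq_iff_add_eq_0
        add.commute)
  also have "\<dots> \<longleftrightarrow> M \<in> hamiltonian_matrices"
  proof
    assume "Omega ** M \<in> Symm"
    hence sym: "(Omega ** M) $ i $ j = (Omega ** M) $ j $ i" for i j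
      by (simp add: Symm_def transpose_def vec_eq_iff)
    define R0 where "R0 = (\<chi> k l. M $ Inl k $ Inl l)"
    define E where "E = (\<chi> k l. M $ Inl k $ Inr l)"
    define F where "F = (\<chi> k l. M $ Inr k $ Inl l)"
    have "M = block_mat R0 E F (- transpose R0)"
      using sym[of "Inl _" "Inr _"]
      by (auto simp: vec_eq_iff block_mat_def R0_def E_def F_def transpose_def Omega_mult_nth
          split: sum.splits)
    moreover have "E \<in> Symm"
      using sym[of "Inr _" "Inr _"] by (simp add: Symm_def E_def transpose_def vec_eq_iff Omega_mult_nth)
    moreover have "F \<in> Symm"
      using sym[of "Inl _" "Inl _"] by (simp add: Symm_def F_def transpose_def vec_eq_iff Omega_mult_nth)
    ultimately show "M \<in> hamiltonian_matrices"
      unfolding hamiltonian_matrices_def by blast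
  next
    assume "M \<in> hamiltonian_matrices"
    then obtain R0 E F where M: "M = block_mat R0 E F (- transpose R0)" "E \<in> Symm" "F \<in> Symm"
      unfolding hamiltonian_matrices_def by blast
    have "E $ k $ l = E $ l $ k" "F $ k $ l = F $ l $ k" for k l
      using M(2,3) by (simp_all add: Symm_def transpose_def vec_eq_iff)
    hence "(Omega ** M) $ i $ j = (Omega ** M) $ j $ i" for i j
      by (cases i; cases j) (simp_all add: Omega_mult_nth, simp_all add: M(1) block_mat_def transpose_def)
    thus "Omega ** M \<in> Symm"
      by (simp add: Symm_def transpose_def vec_eq_iff)
  qed
  finally show ?thesis ..
qed

lemma subspace_hamiltonian_matrices:
  "subspace (hamiltonian_matrices :: (real^('p::finite+'p)^('p+'p)) set)"
proof -
  have "hamiltonian_matrices = {M :: real^('p+'p)^('p+'p). congruence_derivative Omega M = 0}"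
    by (auto simp only: hamiltonian_iff_derivative_zero)
  moreover have "subspace {M :: real^('p+'p)^('p+'p). congruence_derivative Omega M = 0}"
    by (rule linear_subspace_kernel[OF linear_congruence_derivative])
  ultimately show ?thesis by (simp only:)
qed

lemma sp_tangent_eq: "sp_tangent N = congruence_derivative N ` hamiltonian_matrices"
  by (auto simp: sp_tangent_def congruence_derivative_def)

text \<open>
  Since \<open>Omega\<close> squares to \<open>-I\<close>, multiplying \<open>T\<^sup>T Omega T = Omega\<close> by \<open>-Omega\<close> exhibits the
  inverse \<open>-Omega T\<^sup>T Omega\<close>.
\<close>
lemma symplectic_inverse:
  assumes "symplectic T"
  obtains U where "U ** T = mat 1" "T ** U = mat 1" "symplectic U"
proof -
  define U where "U = - (Omega ** transpose T ** Omega)"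
  have T: "transpose T ** Omega ** T = Omega" using assms by (simp add: symplectic_def)
  have "U ** T = - (Omega ** (transpose T ** Omega ** T))"
    by (simp add: U_def matrix_linear_simps matrix_mul_assoc)
  hence UT: "U ** T = mat 1" by (simp add: T Omega_squared)
  hence TU: "T ** U = mat 1" by (simp add: matrix_left_right_inverse)
  have "transpose U ** Omega ** U = transpose (T ** U) ** Omega ** (T ** U)"
    unfolding matrix_transpose_mul by (subst T[symmetric]) (simp only: matrix_mul_assoc)
  hence "symplectic U" by (simp add: TU symplectic_def)
  with UT TU that show ?thesis by blast
qed

lemma williamson_form_congruence_imp:
  assumes "symplectic T" "williamson_form N D"
  shows "williamson_form (transpose T ** N ** T) D"
proof -
  obtain U where U: "U ** T = mat 1" "T ** U = mat 1" "symplectic U"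
    using symplectic_inverse assms(1) by blast
  from assms(2) obtain S where S: "symplectic S" "transpose S ** N ** S = block_mat D 0 0 D"
    by (auto simp: williamson_form_def)
  have TUS: "T ** (U ** S) = S" by (simp add: matrix_mul_assoc U(2))
  have "transpose (U ** S) ** Omega ** (U ** S) = transpose S ** (transpose U ** Omega ** U) ** S"
    by (simp only: matrix_transpose_mul matrix_mul_assoc)
  hence "symplectic (U ** S)" using S(1) U(3) by (simp add: symplectic_def)
  moreover have "transpose (U ** S) ** (transpose T ** N ** T) ** (U ** S)
      = transpose (T ** (U ** S)) ** N ** (T ** (U ** S))"
    by (simp only: matrix_transpose_mul matrix_mul_assoc)
  ultimately show ?thesis
    using assms(2) S(2) unfolding williamson_form_def TUS by metis
qed

lemma williamson_form_congruence_iff: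
  assumes "symplectic T"
  shows "williamson_form (transpose T ** N ** T) D \<longleftrightarrow> williamson_form N D"
proof
  obtain U where U: "U ** T = mat 1" "T ** U = mat 1" "symplectic U"
    using symplectic_inverse assms by blast
  have "transpose U ** (transpose T ** N ** T) ** U = transpose (T ** U) ** N ** (T ** U)"
    by (simp only: matrix_transpose_mul matrix_mul_assoc)
  hence pullback: "transpose U ** (transpose T ** N ** T) ** U = N" by (simp add: U(2))
  assume "williamson_form (transpose T ** N ** T) D"
  from williamson_form_congruence_imp[OF U(3) this] show "williamson_form N D" by (simp only: pullback)
qed (rule williamson_form_congruence_imp[OF assms])

text \<open>
  A symplectic \<open>S\<close> diagonalises \<open>N\<close> exactly if \<open>T\<^sup>-\<^sup>1 S\<close> diagonalises \<open>T\<^sup>T N T\<close>, so both matrices have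
  the same Williamson forms.
\<close>
lemma symplectic_eigenvalues_congruence:
  "symplectic T \<Longrightarrow> symplectic_eigenvalues (transpose T ** N ** T) = symplectic_eigenvalues N"
  by (simp add: symplectic_eigenvalues_def williamson_form_congruence_iff)

lemma pos_def_congruence:
  assumes "pos_def N" "symplectic T"
  shows "pos_def (transpose T ** N ** T)"
  unfolding pos_def_def
proof (intro conjI allI impI)
  show "transpose T ** N ** T \<in> Symm"
    using assms(1) by (simp add: pos_def_def Symm_congruence)
  fix x :: "real^('a + 'a)" assume "x \<noteq> 0"
  obtain U where "U ** T = mat 1" using symplectic_inverse assms(2) by blast
  hence "U *v (T *v x) = x" by (simp add: matrix_vector_mul_assoc)
  with \<open>x \<noteq> 0\<close> have "T *v x \<noteq> 0" by auto
  hence "(T *v x) \<bullet> (N *v (T *v x)) > 0" using assms(1) by (simp add: pos_def_def)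
  also have "(T *v x) \<bullet> (N *v (T *v x)) = x \<bullet> (transpose T *v (N *v (T *v x)))"
    by (metis dot_lmul_matrix transpose_matrix_vector transpose_transpose)
  finally show "x \<bullet> (transpose T ** N ** T *v x) > 0"
    by (simp only: matrix_vector_mul_assoc matrix_mul_assoc)
qed

section \<open>Graph patterns\<close>

text \<open>
  The projection whose kernel is, within the symmetric matrices, the span of \<open>graph_matrices G\<close>;
  it turns the condition that no edge outside \<open>G\<close> occurs into a linear equation.
\<close>
definition nonedge_part :: "'n set set \<Rightarrow> real^'n^'n::finite \<Rightarrow> real^'n^'n" where
  "nonedge_part G A = (\<chi> i j. if i \<noteq> j \<and> {i, j} \<notin> G then A $ i $ j else 0)"

lemma linear_nonedge_part: "linear (nonedge_part G)"
  by (auto intro!: linearI simp: nonedge_part_def vec_eq_iff)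

lemma norm_nonedge_part_le: "norm (nonedge_part G A) \<le> norm A"
  unfolding nonedge_part_def
  by (intro norm_le_componentwise_cart) (auto)

lemma span_graph_matrices_subset:
  "span (graph_matrices G) \<subseteq> Symm \<inter> {A. nonedge_part G A = 0}"
proof (rule span_minimal)
  show "graph_matrices G \<subseteq> Symm \<inter> {A. nonedge_part G A = 0}"
    by (auto simp: graph_matrices_def nonedge_part_def vec_eq_iff)
  show "subspace (Symm \<inter> {A. nonedge_part G A = 0})"
    by (intro subspace_inter subspace_Symm linear_subspace_kernel linear_nonedge_part)
qed

lemma edge_labeled_graph_iff:
  "N \<in> Symm \<Longrightarrow> i \<noteq> j \<Longrightarrow> {i, j} \<in> labeled_graph N \<longleftrightarrow> N $ i $ j \<noteq> 0"
  by (auto simp: labeled_graph_def doubleton_eq_iff Symm_def transpose_def vec_eq_iff)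

section \<open>Openness of the SSSP\<close>

lemma SSSP_wrt_iff_image:
  "SSSP_wrt N G \<longleftrightarrow>
     (\<lambda>(M, T). congruence_derivative N M + T) ` (hamiltonian_matrices \<times> span (graph_matrices G)) = Symm"
proof -
  have "(\<lambda>(M, T). congruence_derivative N M + T) ` (hamiltonian_matrices \<times> span (graph_matrices G))
      = sp_tangent N + span (graph_matrices G)"
    by (auto simp: sp_tangent_eq set_plus_def)
  thus ?thesis by (simp add: SSSP_wrt_def)
qed

text \<open>
  The graph is kept fixed while \<open>N\<close> varies, so the domain of the linear map
  \<open>(M, T) \<mapsto> N M + M\<^sup>T N + T\<close> does not change, and the map is Lipschitz in \<open>N\<close>. Symmetry of \<open>N'\<close>
  ensures that the perturbed map still takes symmetric values.
\<close>
lemma SSSP_wrt_open: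
  assumes "SSSP_wrt N G"
  obtains d where "d > 0" "\<And>N'. N' \<in> Symm \<Longrightarrow> norm (N' - N) < d \<Longrightarrow> SSSP_wrt N' G"
proof -
  define A where "A = (\<lambda>N' (M, T). congruence_derivative N' M + (T :: real^('a+'a)^('a+'a)))"
  have A: "linear (A N')" for N'
    by (auto intro!: linearI simp: A_def linear_add[OF linear_congruence_derivative]
        linear_scale[OF linear_congruence_derivative] algebra_simps)
  let ?U = "hamiltonian_matrices \<times> span (graph_matrices G)"
  have U: "subspace ?U"
    by (intro subspace_Times subspace_hamiltonian_matrices subspace_span)
  obtain e where e: "e > 0" "\<And>B. \<lbrakk>linear B; B ` ?U \<subseteq> Symm;
      \<And>x. norm (B x - A N x) \<le> e * norm x\<rbrakk> \<Longrightarrow> B ` ?U = Symm"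
    using surjection_onto_subspace_stable[OF A U] assms unfolding SSSP_wrt_iff_image A_def by metis
  obtain k where k: "k > 0" "\<And>X Y :: real^('a+'a)^('a+'a).
      norm (congruence_derivative X Y) \<le> norm X * norm Y * k"
    using bounded_bilinear.pos_bounded[OF bounded_bilinear_congruence_derivative] by blast
  show ?thesis
  proof (rule that)
    show "e / k > 0" using e(1) k(1) by simp
    fix N' :: "real^('a+'a)^('a+'a)" assume N': "N' \<in> Symm" "norm (N' - N) < e / k"
    have "A N' ` ?U = Symm"
    proof (rule e(2)[OF A])
      show "A N' ` ?U \<subseteq> Symm"
        using span_graph_matrices_subset[of G]
        by (auto simp: A_def intro!: subspace_add[OF subspace_Symm] Symm_congruence_derivative N'(1))
      fix x :: "(real^('a+'a)^('a+'a)) \<times> (real^('a+'a)^('a+'a))"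
      obtain M T where x: "x = (M, T)" by fastforce
      have "A N' x - A N x = congruence_derivative (N' - N) M"
        by (simp add: A_def x bounded_bilinear.diff_left[OF bounded_bilinear_congruence_derivative])
      also have "norm \<dots> \<le> (norm (N' - N) * k) * norm M"
        using k(2)[of "N' - N" M] by (simp add: mult_ac)
      also have "\<dots> \<le> e * norm x"
        using N'(2) k(1) e(1) norm_fst_le[of M T] by (intro mult_mono) (auto simp: x field_simps)
      finally show "norm (A N' x - A N x) \<le> e * norm x" .
    qed
    thus "SSSP_wrt N' G" by (simp add: SSSP_wrt_iff_image A_def)
  qed
qed

section \<open>The liberated matrix\<close>

text \<open>
  The orbit of \<open>N\<close> under symplectic congruence and the space of matrices with pattern \<open>G\<close> intersect
  transversally at \<open>N\<close>, and \<open>R\<close> is tangent to both; hence a path in the intersection leaves \<open>N\<close> in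
  direction \<open>R\<close>. Transversality enters only in showing that \<open>L\<close> reaches every value of \<open>Q\<close>.
\<close>
lemma symplectic_orbit_meets_pattern:
  fixes N :: "real^('p::finite + 'p)^('p + 'p)"
  assumes N: "N \<in> Symm" "nonedge_part G N = 0" and sssp: "SSSP_wrt N G"
    and R: "R \<in> sp_tangent N" "nonedge_part G R = 0"
  obtains K where
    "\<forall>\<^sub>F t in at_right 0. \<exists>S. symplectic S \<and> nonedge_part G (transpose S ** N ** S) = 0 \<and>
       norm (transpose S ** N ** S - (N + t *\<^sub>R R)) \<le> K * t\<^sup>2"
proof -
  obtain M where M: "M \<in> hamiltonian_matrices" "R = congruence_derivative N M"
    using R(1) by (auto simp: sp_tangent_eq)
  define L where "L X = (congruence_derivative Omega X, nonedge_part G (congruence_derivative N X))" for X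
  define Q where "Q X = (transpose X ** Omega ** X, nonedge_part G (transpose X ** N ** X))"
    for X :: "real^('p + 'p)^('p + 'p)"
  have linL: "linear L"
    by (auto intro!: linearI simp: L_def
        linear_add[OF linear_congruence_derivative] linear_scale[OF linear_congruence_derivative]
        linear_add[OF linear_nonedge_part] linear_scale[OF linear_nonedge_part])
  have LM: "L M = 0"
    using M R(2) by (simp add: L_def hamiltonian_iff_derivative_zero zero_prod_def)
  have contQ: "continuous_on UNIV Q"
    unfolding Q_def
    by (intro continuous_on_Pair continuous_on_compose2[OF linear_continuous_on[OF
            linear_conv_bounded_linear[THEN iffD1, OF linear_nonedge_part]]]
        bounded_bilinear.continuous_on[OF bounded_bilinear_transpose_mult] continuous_intros) auto
  obtain a where a: "a > 0" "\<And>(X :: real^('p+'p)^('p+'p)) (Y :: real^('p+'p)^('p+'p)).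
      norm (transpose X ** Omega ** Y) \<le> norm X * norm Y * a"
    using bounded_bilinear.pos_bounded[OF bounded_bilinear_transpose_mult] by blast
  obtain b where b: "b > 0" "\<And>(X :: real^('p+'p)^('p+'p)) (Y :: real^('p+'p)^('p+'p)).
      norm (transpose X ** N ** Y) \<le> norm X * norm Y * b"
    using bounded_bilinear.pos_bounded[OF bounded_bilinear_transpose_mult] by blast
  have normQ: "norm (Q X) \<le> (a + b) * (norm X)\<^sup>2" for X
  proof -
    have "norm (Q X) \<le> norm (transpose X ** Omega ** X) + norm (transpose X ** N ** X)"
      unfolding Q_def
      by (rule order_trans[OF norm_Pair_le]) (simp add: norm_nonedge_part_le)
    also have "\<dots> \<le> norm X * norm X * a + norm X * norm X * b"
      by (intro add_mono a(2) b(2))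
    finally show ?thesis by (simp add: power2_eq_square algebra_simps)
  qed
  have rangeQ: "range Q \<subseteq> range L"
  proof
    fix q assume "q \<in> range Q"
    then obtain X where q: "q = Q X" by blast
    define B where "B = transpose X ** Omega ** X"
    have skew: "transpose B = - B"
      by (simp add: B_def matrix_transpose_mul transpose_Omega matrix_linear_simps matrix_mul_assoc)
    \<comment> \<open>Half of \<open>Omega\<^sup>-\<^sup>1 B\<close>, where \<open>Omega\<^sup>-\<^sup>1 = - Omega\<close>: the two terms of the derivative each give
      \<open>B / 2\<close> because \<open>B\<close> is skew. A Hamiltonian \<open>Z\<close> can then be added without disturbing this
      component.\<close>
    define Y where "Y = (- 1 / 2) *\<^sub>R (Omega ** B)"
    have "congruence_derivative Omega Y =
        (- 1 / 2) *\<^sub>R (Omega ** Omega ** B) + (- 1 / 2) *\<^sub>R (B ** (Omega ** Omega))"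
      by (simp add: Y_def congruence_derivative_def matrix_linear_simps matrix_transpose_mul skew
          transpose_Omega matrix_mul_assoc)
    hence Y: "congruence_derivative Omega Y = B"
      by (simp add: Omega_squared matrix_linear_simps flip: scaleR_left.add)
    have "transpose X ** N ** X - congruence_derivative N Y \<in> Symm"
      using N(1) by (intro subspace_diff[OF subspace_Symm] Symm_congruence Symm_congruence_derivative)
    then obtain Z T where Z: "Z \<in> hamiltonian_matrices" "T \<in> span (graph_matrices G)"
      and ZT: "transpose X ** N ** X - congruence_derivative N Y = congruence_derivative N Z + T"
      using sssp unfolding SSSP_wrt_iff_image
      by (smt (verit, best) SigmaE case_prod_conv imageE)
    have "nonedge_part G T = 0" using Z(2) span_graph_matrices_subset by blast
    moreover have "transpose X ** N ** X = congruence_derivative N (Y + Z) + T"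
      using ZT by (simp add: linear_add[OF linear_congruence_derivative] algebra_simps)
    ultimately have "L (Y + Z) = q"
      using Z(1) Y
      by (simp add: q L_def Q_def B_def linear_add[OF linear_congruence_derivative]
          linear_add[OF linear_nonedge_part] hamiltonian_iff_derivative_zero)
    thus "q \<in> range L" by blast
  qed
  obtain K where K: "K \<ge> 0"
    "\<forall>\<^sub>F t in at_right 0. \<exists>X. L X + Q X = 0 \<and> norm (X - t *\<^sub>R M) \<le> K * t\<^sup>2"
    using perturbed_linear_equation_solvable[OF linL LM contQ normQ rangeQ] by blast
  obtain c where c: "c > 0" "\<And>X. norm (congruence_derivative N X) \<le> c * norm X"
    using linear_norm_bound[OF linear_congruence_derivative] by blast
  let ?K = "c * K + b * (norm M + K)\<^sup>2"
  have "\<forall>\<^sub>F t in at_right (0::real). 0 < t \<and> t < 1"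
    by (auto simp: eventually_at_right_field intro: exI[of _ 1])
  with K(2) have "\<forall>\<^sub>F t in at_right 0. \<exists>S. symplectic S \<and>
      nonedge_part G (transpose S ** N ** S) = 0 \<and>
      norm (transpose S ** N ** S - (N + t *\<^sub>R R)) \<le> ?K * t\<^sup>2"
  proof eventually_elim
    case (elim t)
    then obtain X where X: "L X + Q X = 0" "norm (X - t *\<^sub>R M) \<le> K * t\<^sup>2" by blast
    have t: "0 < t" "t < 1" using elim by auto
    have NX: "transpose (mat 1 + X) ** N ** (mat 1 + X) =
        N + (congruence_derivative N X + transpose X ** N ** X)"
      by (simp add: congruence_expansion add.assoc)
    have "symplectic (mat 1 + X)"
      using X(1) by (simp add: symplectic_def congruence_expansion L_def Q_def zero_prod_def add.assoc)
    moreover have "nonedge_part G (transpose (mat 1 + X) ** N ** (mat 1 + X)) = 0"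
      using X(1) N(2) unfolding NX by (simp add: linear_add[OF linear_nonedge_part] L_def Q_def zero_prod_def)
    moreover have "norm (transpose (mat 1 + X) ** N ** (mat 1 + X) - (N + t *\<^sub>R R)) \<le> ?K * t\<^sup>2"
    proof -
      have "transpose (mat 1 + X) ** N ** (mat 1 + X) - (N + t *\<^sub>R R)
          = congruence_derivative N (X - t *\<^sub>R M) + transpose X ** N ** X"
        unfolding NX M(2)
        by (simp add: linear_diff[OF linear_congruence_derivative] linear_scale[OF linear_congruence_derivative])
      moreover have "norm (congruence_derivative N (X - t *\<^sub>R M)) \<le> c * (K * t\<^sup>2)"
        using c X(2) by (meson less_imp_le mult_left_mono order_trans)
      moreover have "norm (transpose X ** N ** X) \<le> b * (t * (norm M + K))\<^sup>2"
      proof -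
        have "norm X \<le> norm (t *\<^sub>R M) + norm (X - t *\<^sub>R M)"
          using norm_triangle_ineq[of "t *\<^sub>R M" "X - t *\<^sub>R M"] by simp
        also have "\<dots> \<le> t * norm M + K * t"
          using X(2) t K(1) mult_left_mono[of "t\<^sup>2" t K] by (simp add: power2_eq_square)
        finally have "norm X \<le> t * (norm M + K)" by (simp add: algebra_simps)
        hence "(norm X)\<^sup>2 \<le> (t * (norm M + K))\<^sup>2" by (intro power_mono) auto
        hence "b * (norm X)\<^sup>2 \<le> b * (t * (norm M + K))\<^sup>2" using b(1) by simp
        with b(2)[of X X] show ?thesis by (simp add: power2_eq_square mult_ac)
      qed
      ultimately have "norm (transpose (mat 1 + X) ** N ** (mat 1 + X) - (N + t *\<^sub>R R))
          \<le> c * (K * t\<^sup>2) + b * (t * (norm M + K))\<^sup>2"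
        by (metis norm_triangle_mono)
      moreover have "c * (K * t\<^sup>2) + b * (t * s)\<^sup>2 = (c * K + b * s\<^sup>2) * t\<^sup>2" for s
        by (simp add: power_mult_distrib algebra_simps)
      ultimately show ?thesis by simp
    qed
    ultimately show ?case by blast
  qed
  thus ?thesis using that by blast
qed

text \<open>
  An entry of \<open>N + t R\<close> that does not vanish identically in \<open>t\<close> is at least of order \<open>t\<close>, so it
  survives every perturbation of order \<open>t\<^sup>2\<close>.
\<close>
lemma eventually_nonzero_entries:
  fixes N R :: "real^'n^'n::finite"
  shows "\<forall>\<^sub>F t in at_right 0. \<forall>A. norm (A - (N + t *\<^sub>R R)) \<le> K * t\<^sup>2 \<longrightarrow>
           (\<forall>i j. N $ i $ j \<noteq> 0 \<or> R $ i $ j \<noteq> 0 \<longrightarrow> A $ i $ j \<noteq> 0)"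
proof -
  have ev: "\<forall>\<^sub>F t in at_right 0. x \<noteq> 0 \<or> r \<noteq> 0 \<longrightarrow> K * t\<^sup>2 < \<bar>x + t * r\<bar>" for x r :: real
  proof (cases "x = 0")
    case False
    have "((\<lambda>t. \<bar>x + t * r\<bar> - K * t\<^sup>2) \<longlongrightarrow> \<bar>x + 0 * r\<bar> - K * 0\<^sup>2) (at_right 0)"
      by (intro tendsto_intros)
    hence "\<forall>\<^sub>F t in at_right 0. 0 < \<bar>x + t * r\<bar> - K * t\<^sup>2"
      using False by (intro order_tendstoD(1)) auto
    thus ?thesis by eventually_elim simp
  next
    case True
    show ?thesis
    proof (cases "r = 0")
      case False
      have "((\<lambda>t. K * t) \<longlongrightarrow> K * 0) (at_right 0)"
        by (intro tendsto_intros)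
      hence "\<forall>\<^sub>F t in at_right 0. K * t < \<bar>r\<bar>"
        using False by (intro order_tendstoD(2)) auto
      moreover have "\<forall>\<^sub>F t in at_right (0::real). 0 < t"
        by (rule eventually_at_right_less)
      ultimately show ?thesis
      proof eventually_elim
        case (elim t)
        hence "t * (K * t) < t * \<bar>r\<bar>" by simp
        with elim(2) True show ?case by (simp add: power2_eq_square abs_mult mult_ac)
      qed
    qed (use True in simp)
  qed
  have "\<forall>\<^sub>F t in at_right 0. \<forall>i j. N $ i $ j \<noteq> 0 \<or> R $ i $ j \<noteq> 0 \<longrightarrow>
          K * t\<^sup>2 < \<bar>N $ i $ j + t * R $ i $ j\<bar>"
    by (intro eventually_all_finite ev)
  thus ?thesis
  proof eventually_elim
    case (elim t)
    show ?case
    proof (intro allI impI)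
      fix A i j assume A: "norm (A - (N + t *\<^sub>R R)) \<le> K * t\<^sup>2" and ij: "N $ i $ j \<noteq> 0 \<or> R $ i $ j \<noteq> 0"
      have "\<bar>(A - (N + t *\<^sub>R R)) $ i $ j\<bar> \<le> K * t\<^sup>2"
        by (rule order_trans[OF component_le_norm_cart order_trans[OF Finite_Cartesian_Product.norm_nth_le A]])
      with elim ij show "A $ i $ j \<noteq> 0" by fastforce
    qed
  qed
qed

theorem theorem3p20:
  fixes N R :: "real^('p::finite + 'p)^('p + 'p)"
    and G :: "('p + 'p) set set"
  assumes "pos_def N"
    and "G = labeled_graph N"
    and "R \<in> sp_tangent N"
    and "SSSP_wrt N (directed_extension G R)"
  shows "\<exists>N'. pos_def N' \<and> labeled_graph N' = directed_extension G R \<and>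
    symplectic_eigenvalues N' = symplectic_eigenvalues N \<and> SSSP N'"
proof -
  let ?H = "directed_extension G R"
  have N: "N \<in> Symm" using assms(1) by (simp add: pos_def_def)
  have R: "R \<in> Symm"
    using assms(3) N by (auto simp: sp_tangent_eq Symm_congruence_derivative)
  have H: "{i, j} \<in> ?H \<longleftrightarrow> N $ i $ j \<noteq> 0 \<or> R $ i $ j \<noteq> 0" if "i \<noteq> j" for i j
    using edge_labeled_graph_iff[OF N that] edge_labeled_graph_iff[OF R that]
    by (simp add: directed_extension_def assms(2) labeled_graph_def)
  have pattern: "nonedge_part ?H N = 0" "nonedge_part ?H R = 0"
    using H by (auto simp: nonedge_part_def vec_eq_iff)
  obtain K where K: "\<forall>\<^sub>F t in at_right 0. \<exists>S. symplectic S \<and>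
      nonedge_part ?H (transpose S ** N ** S) = 0 \<and>
      norm (transpose S ** N ** S - (N + t *\<^sub>R R)) \<le> K * t\<^sup>2"
    by (rule symplectic_orbit_meets_pattern[OF N pattern(1) assms(4,3) pattern(2)])
  obtain d where d: "d > 0" "\<And>N'. N' \<in> Symm \<Longrightarrow> norm (N' - N) < d \<Longrightarrow> SSSP_wrt N' ?H"
    using SSSP_wrt_open[OF assms(4)] by blast
  have "((\<lambda>t. \<bar>t\<bar> * norm R + K * t\<^sup>2) \<longlongrightarrow> \<bar>0\<bar> * norm R + K * 0\<^sup>2) (at_right 0)"
    by (intro tendsto_intros)
  hence "\<forall>\<^sub>F t in at_right 0. \<bar>t\<bar> * norm R + K * t\<^sup>2 < d"
    using d(1) by (intro order_tendstoD(2)) auto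
  with K eventually_nonzero_entries[of N R K]
  have "\<forall>\<^sub>F t in at_right (0::real). \<exists>S. symplectic S \<and>
      nonedge_part ?H (transpose S ** N ** S) = 0 \<and> norm (transpose S ** N ** S - N) < d \<and>
      (\<forall>i j. N $ i $ j \<noteq> 0 \<or> R $ i $ j \<noteq> 0 \<longrightarrow> (transpose S ** N ** S) $ i $ j \<noteq> 0)"
  proof eventually_elim
    case (elim t)
    then obtain S where S: "symplectic S" "nonedge_part ?H (transpose S ** N ** S) = 0"
      "norm (transpose S ** N ** S - (N + t *\<^sub>R R)) \<le> K * t\<^sup>2" by blast
    have "norm (transpose S ** N ** S - N) \<le> norm (transpose S ** N ** S - (N + t *\<^sub>R R)) + norm (t *\<^sub>R R)"
      using norm_triangle_ineq[of "transpose S ** N ** S - (N + t *\<^sub>R R)" "t *\<^sub>R R"] by simp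
    hence "norm (transpose S ** N ** S - N) < d" using S(3) elim(3) by simp
    with S elim(2) show ?case by blast
  qed
  then obtain t :: real and S where S: "symplectic S"
      "nonedge_part ?H (transpose S ** N ** S) = 0" "norm (transpose S ** N ** S - N) < d"
      "\<And>i j. N $ i $ j \<noteq> 0 \<or> R $ i $ j \<noteq> 0 \<Longrightarrow> (transpose S ** N ** S) $ i $ j \<noteq> 0"
    using eventually_happens'[OF trivial_limit_at_right_real] by blast
  define N' where "N' = transpose S ** N ** S"
  have N': "N' \<in> Symm" using N by (simp add: N'_def Symm_congruence)
  have edge: "N' $ i $ j \<noteq> 0 \<longleftrightarrow> N $ i $ j \<noteq> 0 \<or> R $ i $ j \<noteq> 0" if "i \<noteq> j" for i j
  proof -
    have "nonedge_part ?H N' $ i $ j = 0" using S(2) by (simp add: N'_def)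
    hence "{i, j} \<notin> ?H \<Longrightarrow> N' $ i $ j = 0" using that by (simp add: nonedge_part_def)
    with S(4) H[OF that] show ?thesis unfolding N'_def by blast
  qed
  have "labeled_graph N' = ?H"
    unfolding directed_extension_def assms(2) labeled_graph_def using edge by blast
  moreover from this have "SSSP N'"
    using d(2)[OF N'] S(3) by (simp add: SSSP_def N'_def)
  ultimately show ?thesis
    using pos_def_congruence[OF assms(1) S(1)] symplectic_eigenvalues_congruence[OF S(1)]
    unfolding N'_def by blast
qed

end
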